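(* Let $P$ and $Q$ be graded posets of rank at least $1$. Then the flag $f$-vector of the Tchebyshev transform of the Cartesian product $P\times Q$ equals the flag $f$-vector of the dual diamond product of the Tchebyshev transforms $T(P)$ and $T(Q)$, that is, $$\Psi(T(P\times Q))=\Psi(T(P)\diamond^{*}T(Q)).$$
   Context: All graded posets are finite, with minimal element $\widehat{0}$, maximal element $\widehat{1}$ and rank function $\rho$; $\rho(x,y)=\rho(y)-\rho(x)$. For a graded poset $P$ of rank at least $1$, the weight of a chain $c=\{\widehat 0=x_0<x_1<\cdots<x_k=\widehat 1\}$ is $\mathrm{wt}(c)=(\mathbf{a}-\mathbf{b})^{\rho(x_0,x_1)-1}\cdot\mathbf{b}\cdot(\mathbf{a}-\mathbf{b})^{\rho(x_1,x_2)-1}\cdot\mathbf{b}\cdots\mathbf{b}\cdot(\mathbf{a}-\mathbf{b})^{\rho(x_{k-1},x_k)-1}$ in noncommuting variables $\mathbf{a},\mathbf{b}$, and the $\mathbf{ab}$-index is $\Psi(P)=\sum_c\mathrm{wt}(c)$ over all such chains; it encodes the flag $f$-vector of $P$. $P\times Q$ is the Cartesian product with componentwise order. The dual diamond product is $P\diamond^{*}Q=(P-\{\widehat 1\})\times(Q-\{\widehat 1\})\cup\{\widehat 1\}$, i.e. the Cartesian product of $P-\{\widehat 1_P\}$ and $Q-\{\widehat 1_Q\}$ with a new maximal element adjoined. Tchebyshev transform: let $P\cup\{\widehat{-1}\}$ be $P$ with a new minimal element $\widehat{-1}$ adjoined. $T(P)$ is the graded poset with elements $[x,y]$ for $x,y\in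 P\cup\{\widehat{-1}\}$, $x<y$, together with a maximal element $\widehat{1}_{T(P)}$, with cover relations: (i) $[x,y]\prec[y,w]$ if $y\prec w$; (ii) $[x,y]\prec[x,w]$ if $y\prec w$; (iii) $[x,\widehat 1]\prec\widehat{1}_{T(P)}$. *)

theory Defs
  imports "HOL-Algebra.Order" "HOL-Library.Poly_Mapping"
begin

section \<open>Noncommutative polynomials in two variables\<close>

text \<open>
  \<open>ab_poly\<close> is the free associative ring on \<open>a\<close>, \<open>b\<close> over the integers, realised as the monoid
  ring of the free monoid of words. The convolution product of \<open>poly_mapping\<close> expects the monoid
  of exponents in additive notation, so concatenation of words is written \<open>+\<close>; it is not
  commutative.
\<close>

datatype letter = Letter_a | Letter_b

datatype ab_word = Word "letter list"

instantiation ab_word :: monoid_add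
begin

definition zero_ab_word :: ab_word where
  "0 = Word []"

fun plus_ab_word :: "ab_word \<Rightarrow> ab_word \<Rightarrow> ab_word" where
  "Word u + Word v = Word (u @ v)"

instance
proof
  fix x y z :: ab_word
  show "x + y + z = x + (y + z)" by (cases x; cases y; cases z) simp
  show "0 + x = x" by (cases x) (simp add: zero_ab_word_def)
  show "x + 0 = x" by (cases x) (simp add: zero_ab_word_def)
qed

end

type_synonym ab_poly = "ab_word \<Rightarrow>\<^sub>0 int"

definition var_a :: ab_poly where
  "var_a = Poly_Mapping.single (Word [Letter_a]) 1"

definition var_b :: ab_poly where
  "var_b = Poly_Mapping.single (Word [Letter_b]) 1"


section \<open>Graded posets\<close>

definition covers :: "'a gorder \<Rightarrow> 'a \<Rightarrow> 'a \<Rightarrow> bool" where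
  "covers P x y \<longleftrightarrow> x \<in> carrier P \<and> y \<in> carrier P \<and> x \<sqsubset>\<^bsub>P\<^esub> y \<and>
     (\<nexists>z. z \<in> carrier P \<and> x \<sqsubset>\<^bsub>P\<^esub> z \<and> z \<sqsubset>\<^bsub>P\<^esub> y)"

definition is_rank_function :: "'a gorder \<Rightarrow> ('a \<Rightarrow> nat) \<Rightarrow> bool" where
  "is_rank_function P \<rho> \<longleftrightarrow> \<rho> \<bottom>\<^bsub>P\<^esub> = 0 \<and> (\<forall>x y. covers P x y \<longrightarrow> \<rho> y = \<rho> x + 1)"

locale graded_poset = partial_order P for P :: "'a gorder" (structure) +
  assumes finite_carrier: "finite (carrier P)"
    and least_exists: "\<exists>x. least P x (carrier P)"
    and greatest_exists: "\<exists>x. greatest P x (carrier P)"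
    and rank_function_exists: "\<exists>\<rho>. is_rank_function P \<rho>"

text \<open>In a graded poset the rank function is uniquely determined on the carrier.\<close>

definition rk :: "'a gorder \<Rightarrow> 'a \<Rightarrow> nat" where
  "rk P = (SOME \<rho>. is_rank_function P \<rho>)"


section \<open>The \<open>ab\<close>-index\<close>

text \<open>A chain is represented by the strictly increasing list of its elements.\<close>

definition chains :: "'a gorder \<Rightarrow> 'a list set" where
  "chains P = {xs. xs \<noteq> [] \<and> set xs \<subseteq> carrier P \<and> sorted_wrt (\<lambda>x y. x \<sqsubset>\<^bsub>P\<^esub> y) xs \<and>
     hd xs = \<bottom>\<^bsub>P\<^esub> \<and> last xs = \<top>\<^bsub>P\<^esub>}"

text \<open>
  The weight is only meaningful for chains with at least two elements, and these are all the
  chains of a poset of rank at least \<open>1\<close>; the third equation is a dummy.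
\<close>

fun wt :: "('a \<Rightarrow> nat) \<Rightarrow> 'a list \<Rightarrow> ab_poly" where
  "wt \<rho> [x, y] = (var_a - var_b) ^ (\<rho> y - \<rho> x - 1)"
| "wt \<rho> (x # y # z # xs) = (var_a - var_b) ^ (\<rho> y - \<rho> x - 1) * var_b * wt \<rho> (y # z # xs)"
| "wt \<rho> _ = 0"

definition ab_index :: "'a gorder \<Rightarrow> ab_poly" (\<open>\<Psi>\<close>) where
  "\<Psi> P = (\<Sum>c\<in>chains P. wt (rk P) c)"


section \<open>Constructions\<close>

definition poset_prod :: "'a gorder \<Rightarrow> 'b gorder \<Rightarrow> ('a \<times> 'b) gorder" (infixr \<open>\<times>\<^sub>p\<close> 80) where
  "P \<times>\<^sub>p Q = \<lparr>carrier = carrier P \<times> carrier Q, eq = (=),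
     le = (\<lambda>(x, y) (x', y'). x \<sqsubseteq>\<^bsub>P\<^esub> x' \<and> y \<sqsubseteq>\<^bsub>Q\<^esub> y')\<rparr>"

text \<open>
  In \<open>adjoin_bottom\<close> the value \<open>None\<close> is the new minimal element; in \<open>adjoin_top\<close> it is the new
  maximal element.
\<close>

definition adjoin_bottom :: "'a gorder \<Rightarrow> 'a option gorder" where
  "adjoin_bottom P = \<lparr>carrier = insert None (Some ` carrier P), eq = (=),
     le = (\<lambda>u v. case u of None \<Rightarrow> True
       | Some x \<Rightarrow> (case v of None \<Rightarrow> False | Some y \<Rightarrow> x \<sqsubseteq>\<^bsub>P\<^esub> y))\<rparr>"

definition adjoin_top :: "'a gorder \<Rightarrow> 'a option gorder" where
  "adjoin_top P = \<lparr>carrier = insert None (Some ` carrier P), eq = (=),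
     le = (\<lambda>u v. case v of None \<Rightarrow> True
       | Some y \<Rightarrow> (case u of None \<Rightarrow> False | Some x \<Rightarrow> x \<sqsubseteq>\<^bsub>P\<^esub> y))\<rparr>"

definition remove_top :: "'a gorder \<Rightarrow> 'a gorder" where
  "remove_top P = P\<lparr>carrier := carrier P - {\<top>\<^bsub>P\<^esub>}\<rparr>"

definition dual_diamond :: "'a gorder \<Rightarrow> 'b gorder \<Rightarrow> ('a \<times> 'b) option gorder" (infixr \<open>\<diamondop>\<^sup>*\<close> 80)
  where "P \<diamondop>\<^sup>* Q = adjoin_top (remove_top P \<times>\<^sub>p remove_top Q)"

text \<open>
  An element \<open>[x, y]\<close> of the Tchebyshev transform is \<open>Some (x, y)\<close>, where \<open>x\<close> and \<open>y\<close> are elements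
  of \<open>adjoin_bottom P\<close>; the maximal element of the transform is \<open>None\<close>.
\<close>

definition intervals :: "'a gorder \<Rightarrow> ('a option \<times> 'a option) set" where
  "intervals P = {(x, y). x \<in> carrier (adjoin_bottom P) \<and> y \<in> carrier (adjoin_bottom P) \<and>
     x \<sqsubset>\<^bsub>adjoin_bottom P\<^esub> y}"

inductive tchebyshev_cover ::
    "'a gorder \<Rightarrow> ('a option \<times> 'a option) option \<Rightarrow> ('a option \<times> 'a option) option \<Rightarrow> bool"
  for P :: "'a gorder" where
  shift: "(x, y) \<in> intervals P \<Longrightarrow> covers (adjoin_bottom P) y w \<Longrightarrow>
    tchebyshev_cover P (Some (x, y)) (Some (y, w))"
| extend: "(x, y) \<in> intervals P \<Longrightarrow> covers (adjoin_bottom P) y w \<Longrightarrow>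
    tchebyshev_cover P (Some (x, y)) (Some (x, w))"
| top: "(x, Some \<top>\<^bsub>P\<^esub>) \<in> intervals P \<Longrightarrow> tchebyshev_cover P (Some (x, Some \<top>\<^bsub>P\<^esub>)) None"

text \<open>The order of the transform is the one generated by its cover relations.\<close>

definition tchebyshev :: "'a gorder \<Rightarrow> ('a option \<times> 'a option) option gorder" where
  "tchebyshev P = \<lparr>carrier = insert None (Some ` intervals P), eq = (=),
     le = (tchebyshev_cover P)\<^sup>*\<^sup>*\<rparr>"

end

theory Submission
  imports Defs
begin

text \<open>
  The two posets have different elements and different chains; what they share is a projection
  onto \<open>P \<times>\<^sub>p Q\<close> whose fibres have the same sizes.

  Send an element \<open>[x, y]\<close> of \<open>T(R)\<close> to \<open>y\<close>. This preserves ranks, so a chain of \<open>T(R)\<close> that starts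
  at the minimal element \<open>[-1, 0]\<close> and avoids the maximal one lies over a chain
  \<open>0 = y\<^sub>0 < \<dots> < y\<^sub>k\<close> of \<open>R\<close>. Lift the latter one element at a time: if \<open>[x, y]\<close> has been chosen, then
  the elements above it that lie over some \<open>y' \<ge> y\<close> are \<open>[x, y']\<close> and the \<open>[z, y']\<close> with
  \<open>y \<le> z < y'\<close>. Encoding \<open>[x, y']\<close> by \<open>z = y'\<close>, they correspond to the elements \<open>z\<close> of the interval
  from \<open>y\<close> to \<open>y'\<close>, and their number does not depend on \<open>x\<close>. Hence a chain of \<open>R\<close> has as many lifts
  as the product of the sizes of the intervals between its consecutive elements, and \<open>\<Psi> (T(R))\<close>
  is a sum over chains of \<open>R\<close> that mentions only these sizes and the ranks.

  The count includes \<open>y' = y\<close>, where both sides equal \<open>1\<close>. That is what makes it multiplicative: an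
  interval of \<open>P \<times>\<^sub>p Q\<close> is a product of intervals, one of which may be a single point, and the
  elements above a given one in \<open>T(P) \<diamondop>\<^sup>* T(Q)\<close> are pairs. So \<open>T(P) \<diamondop>\<^sup>* T(Q)\<close> projects onto
  \<open>P \<times>\<^sub>p Q\<close> with the same fibre sizes as \<open>T(P \<times>\<^sub>p Q)\<close>, and the same sum computes both \<open>ab\<close>-indices.

  The locale \<open>interval_fibration\<close> captures such projections. Its theorem
  \<open>ab_index_eq_interval_chain_sum\<close> is the lifting argument, \<open>interval_fibration_tchebyshev\<close> is the
  fibre count in \<open>T(R)\<close>, and \<open>interval_fibration_dual_diamond\<close> is the closure under products.
\<close>

section \<open>Finite posets and their covers\<close>

context partial_order
begin

(* As introduction rules these resolve with one another without end. *)
declare weak_refl [rule del] le_cong_l [rule del] le_cong_r [rule del] le_antisym [rule del]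

end

lemma partial_orderI:
  assumes "eq P = (=)"
    and "\<And>x. x \<in> carrier P \<Longrightarrow> x \<sqsubseteq>\<^bsub>P\<^esub> x"
    and "\<And>x y. \<lbrakk>x \<in> carrier P; y \<in> carrier P; x \<sqsubseteq>\<^bsub>P\<^esub> y; y \<sqsubseteq>\<^bsub>P\<^esub> x\<rbrakk> \<Longrightarrow> x = y"
    and "\<And>x y z. \<lbrakk>x \<in> carrier P; y \<in> carrier P; z \<in> carrier P; x \<sqsubseteq>\<^bsub>P\<^esub> y; y \<sqsubseteq>\<^bsub>P\<^esub> z\<rbrakk>
      \<Longrightarrow> x \<sqsubseteq>\<^bsub>P\<^esub> z"
  shows "partial_order P"
proof unfold_locales
  show "x \<sqsubseteq>\<^bsub>P\<^esub> z" if "x \<sqsubseteq>\<^bsub>P\<^esub> y" "y \<sqsubseteq>\<^bsub>P\<^esub> z" "x \<in> carrier P" "y \<in> carrier P" "z \<in> carrier P" for x y z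
    using assms(4)[of x y z] that by simp
qed (use assms(1-3) in simp_all)

text \<open>
  Every interval is finite, so a relation that is not a cover can be refined at an intermediate
  element into two relations across smaller intervals.
\<close>

lemma covers_path:
  assumes "partial_order P" and fin: "finite (carrier P)"
    and "x \<in> carrier P" "y \<in> carrier P" "x \<sqsubseteq>\<^bsub>P\<^esub> y"
  shows "(covers P)\<^sup>*\<^sup>* x y"
proof -
  interpret partial_order P by fact
  show ?thesis
    using assms(3-)
  proof (induction "card \<lbrace>x..y\<rbrace>\<^bsub>P\<^esub>" arbitrary: x y rule: less_induct)
    case less
    have finI: "finite \<lbrace>x..y\<rbrace>\<^bsub>P\<^esub>"
      using fin at_least_at_most_closed by (rule rev_finite_subset)
    consider "x = y" | "covers P x y"
      | z where "z \<in> carrier P" "x \<sqsubset>\<^bsub>P\<^esub> z" "z \<sqsubset>\<^bsub>P\<^esub> y"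
      using less.prems by (auto simp: covers_def lless_eq)
    then show ?case
    proof cases
      case 3
      have "\<lbrace>x..z\<rbrace>\<^bsub>P\<^esub> \<subset> \<lbrace>x..y\<rbrace>\<^bsub>P\<^esub>" "\<lbrace>z..y\<rbrace>\<^bsub>P\<^esub> \<subset> \<lbrace>x..y\<rbrace>\<^bsub>P\<^esub>"
      proof -
        have "\<lbrace>x..z\<rbrace>\<^bsub>P\<^esub> \<subseteq> \<lbrace>x..y\<rbrace>\<^bsub>P\<^esub>" "\<lbrace>z..y\<rbrace>\<^bsub>P\<^esub> \<subseteq> \<lbrace>x..y\<rbrace>\<^bsub>P\<^esub>"
          using 3 less.prems le_trans[of _ z y] le_trans[of x z]
          by (auto simp: at_least_at_most_def lless_eq)
        moreover have "x \<in> \<lbrace>x..y\<rbrace>\<^bsub>P\<^esub> - \<lbrace>z..y\<rbrace>\<^bsub>P\<^esub>" "y \<in> \<lbrace>x..y\<rbrace>\<^bsub>P\<^esub> - \<lbrace>x..z\<rbrace>\<^bsub>P\<^esub>"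
          using 3 less.prems le_antisym[of x z] le_antisym[of z y]
          by (auto simp: at_least_at_most_def lless_eq)
        ultimately show "\<lbrace>x..z\<rbrace>\<^bsub>P\<^esub> \<subset> \<lbrace>x..y\<rbrace>\<^bsub>P\<^esub>" "\<lbrace>z..y\<rbrace>\<^bsub>P\<^esub> \<subset> \<lbrace>x..y\<rbrace>\<^bsub>P\<^esub>" by blast+
      qed
      then have "(covers P)\<^sup>*\<^sup>* x z" "(covers P)\<^sup>*\<^sup>* z y"
        using 3 less.prems less.hyps[OF psubset_card_mono[OF finI]] by (simp_all add: lless_eq)
      then show ?thesis by simp
    qed auto
  qed
qed

text \<open>
  The rank functions of the Tchebyshev transform and of the dual diamond product are read off from
  a base poset. This locale holds what can be said before such a function is known.
\<close>

locale finite_bounded_poset = partial_order P for P :: "'a gorder" (structure) +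
  assumes finite_carrier: "finite (carrier P)"
    and least_exists: "\<exists>x. least P x (carrier P)"
    and greatest_exists: "\<exists>x. greatest P x (carrier P)"
begin

sublocale weak_partial_order_bottom P by unfold_locales (rule least_exists)
sublocale weak_partial_order_top P by unfold_locales (rule greatest_exists)

lemma bottom_eqI: "least P x (carrier P) \<Longrightarrow> \<bottom> = x"
  by (rule least_unique[OF bottom_least])

lemma top_eqI: "greatest P x (carrier P) \<Longrightarrow> \<top> = x"
  by (rule greatest_unique[OF top_greatest])

text \<open>
  Along a path of covers from the bottom, a rank function is forced to count the steps. This
  pins down the function chosen in the definition of \<open>rk\<close> on all of the carrier.
\<close>

lemma rk_eqI:
  assumes "is_rank_function P \<rho>" and "x \<in> carrier P"
  shows "rk P x = \<rho> x"
proof -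
  have "is_rank_function P (rk P)"
    using someI[of "is_rank_function P", OF assms(1)] by (simp add: rk_def)
  moreover have "(covers P)\<^sup>*\<^sup>* \<bottom> x"
    using assms(2) by (intro covers_path partial_order_axioms finite_carrier) auto
  then have "r x = \<rho> x" if "is_rank_function P r" for r
    by induction (use assms(1) that in \<open>auto simp: is_rank_function_def\<close>)
  ultimately show ?thesis by blast
qed

lemma finite_interval: "finite \<lbrace>x..y\<rbrace>"
  using finite_carrier at_least_at_most_closed by (rule rev_finite_subset)

end

sublocale graded_poset \<subseteq> finite_bounded_poset
  using finite_carrier least_exists greatest_exists by unfold_locales

lemma (in graded_poset) is_rank_function_rk: "is_rank_function P (rk P)"
  using someI_ex[OF rank_function_exists] by (simp add: rk_def)


section \<open>Chains weighted by the sizes of their intervals\<close>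

definition chains_from :: "'a gorder \<Rightarrow> 'a set \<Rightarrow> 'a \<Rightarrow> 'a list set" where
  "chains_from P S x =
    {x # xs |xs. set (x # xs) \<subseteq> S \<and> sorted_wrt (\<lambda>x y. x \<sqsubset>\<^bsub>P\<^esub> y) (x # xs)}"

fun interval_product :: "'a gorder \<Rightarrow> 'a list \<Rightarrow> nat" where
  "interval_product P (x # y # ys) = card \<lbrace>x..y\<rbrace>\<^bsub>P\<^esub> * interval_product P (y # ys)"
| "interval_product P _ = 1"

text \<open>
  This is the \<open>ab\<close>-index of a poset that projects onto \<open>P\<close>. The chains of \<open>P\<close> end anywhere, since
  they are images of chains whose maximal element has been cut off; the final entry
  \<open>rk P \<top>\<^bsub>P\<^esub> + 1\<close> of the list of ranks restores the rank of that element.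
\<close>

definition interval_chain_sum :: "'a gorder \<Rightarrow> ab_poly" where
  "interval_chain_sum P = (\<Sum>ys\<in>chains_from P (carrier P) \<bottom>\<^bsub>P\<^esub>.
     of_nat (interval_product P ys) * wt id (map (rk P) ys @ [rk P \<top>\<^bsub>P\<^esub> + 1]))"

lemma wt_map: "wt \<rho> xs = wt id (map \<rho> xs)"
  by (induction \<rho> xs rule: wt.induct) auto

lemma (in finite_bounded_poset) finite_chains_from:
  assumes "S \<subseteq> carrier P"
  shows "finite (chains_from P S x)"
proof (rule finite_subset)
  have "sorted_wrt (\<lambda>x y. x \<sqsubset> y) xs \<Longrightarrow> distinct xs" for xs
    by (induction xs) (auto simp: lless_eq)
  then show "chains_from P S x \<subseteq> {xs. set xs \<subseteq> carrier P \<and> distinct xs}"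
    using assms unfolding chains_from_def by blast
  show "finite {xs. set xs \<subseteq> carrier P \<and> distinct xs}"
    by (rule finite_subset_distinct[OF finite_carrier])
qed

text \<open>
  The number of ways to go up from \<open>u\<close> to the fibre over \<open>y\<close> is the size of an interval of \<open>B\<close>, and
  thus depends on \<open>u\<close> through \<open>\<pi> u\<close> alone. Taking \<open>y = \<pi> u\<close> shows that distinct elements of one
  fibre are incomparable, and taking \<open>y\<close> not above \<open>\<pi> u\<close> shows that \<open>\<pi>\<close> is monotone. The values of
  \<open>\<pi>\<close> on covers make it compatible with ranks.
\<close>

locale interval_fibration = A: finite_bounded_poset A + B: graded_poset B
  for A :: "'a gorder" and B :: "'b gorder" and \<pi> :: "'a \<Rightarrow> 'b" +
  assumes bottom_neq_top: "\<bottom>\<^bsub>A\<^esub> \<noteq> \<top>\<^bsub>A\<^esub>"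
    and proj_closed: "u \<in> carrier A - {\<top>\<^bsub>A\<^esub>} \<Longrightarrow> \<pi> u \<in> carrier B"
    and proj_bottom: "\<pi> \<bottom>\<^bsub>A\<^esub> = \<bottom>\<^bsub>B\<^esub>"
    and proj_covers: "covers A u v \<Longrightarrow> v \<noteq> \<top>\<^bsub>A\<^esub> \<Longrightarrow> covers B (\<pi> u) (\<pi> v)"
    and card_fibre: "u \<in> carrier A - {\<top>\<^bsub>A\<^esub>} \<Longrightarrow> y \<in> carrier B \<Longrightarrow>
      card {v \<in> carrier A - {\<top>\<^bsub>A\<^esub>}. u \<sqsubseteq>\<^bsub>A\<^esub> v \<and> \<pi> v = y} = card \<lbrace>\<pi> u..y\<rbrace>\<^bsub>B\<^esub>"
begin

abbreviation "proper \<equiv> carrier A - {\<top>\<^bsub>A\<^esub>}"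

abbreviation "fibre u y \<equiv> {v \<in> proper. u \<sqsubseteq>\<^bsub>A\<^esub> v \<and> \<pi> v = y}"

lemma finite_fibre: "finite (fibre u y)"
  using A.finite_carrier by simp

lemma bottom_proper: "\<bottom>\<^bsub>A\<^esub> \<in> proper"
  using bottom_neq_top by simp

lemma proj_strict_mono:
  assumes u: "u \<in> proper" and v: "v \<in> proper" and "u \<sqsubset>\<^bsub>A\<^esub> v"
  shows "\<pi> u \<sqsubset>\<^bsub>B\<^esub> \<pi> v"
proof -
  have uv: "u \<sqsubseteq>\<^bsub>A\<^esub> v" "u \<noteq> v" using assms(3) by (auto simp: A.lless_eq)
  have "card \<lbrace>\<pi> u..\<pi> v\<rbrace>\<^bsub>B\<^esub> \<noteq> 0"
  proof -
    have "v \<in> fibre u (\<pi> v)" using v uv by simp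
    then have "card (fibre u (\<pi> v)) \<noteq> 0" using finite_fibre[of u "\<pi> v"] card_0_eq by blast
    then show ?thesis using card_fibre[OF u proj_closed[OF v]] by simp
  qed
  then obtain z where "z \<in> \<lbrace>\<pi> u..\<pi> v\<rbrace>\<^bsub>B\<^esub>" by (metis card.empty ex_in_conv)
  then have le: "\<pi> u \<sqsubseteq>\<^bsub>B\<^esub> \<pi> v"
    using proj_closed[OF u] proj_closed[OF v] B.le_trans[of "\<pi> u" z "\<pi> v"]
    by (simp add: at_least_at_most_def)
  have "\<pi> u \<noteq> \<pi> v"
  proof
    assume eq: "\<pi> u = \<pi> v"
    have "\<lbrace>\<pi> u..\<pi> u\<rbrace>\<^bsub>B\<^esub> = {\<pi> u}"
      using proj_closed[OF u] by (auto simp: at_least_at_most_def intro: B.le_antisym)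
    then have "card (fibre u (\<pi> u)) = 1"
      using card_fibre[OF u proj_closed[OF u]] by simp
    then obtain w where "fibre u (\<pi> u) = {w}" by (rule card_1_singletonE)
    moreover have "u \<in> fibre u (\<pi> u)" using u by simp
    moreover have "v \<in> fibre u (\<pi> u)" using v uv eq by simp
    ultimately have "u = w" "v = w" by (metis singletonD)+
    then show False using uv by simp
  qed
  with le show ?thesis by (simp add: B.lless_eq)
qed

text \<open>
  The one kind of cover that \<open>proj_covers\<close> leaves open is a cover of \<open>u\<close> by the top. There the fibre
  over \<open>\<top>\<^bsub>B\<^esub>\<close> contains an element above \<open>u\<close>, which can only be \<open>u\<close> itself, so that \<open>\<pi> u = \<top>\<^bsub>B\<^esub>\<close>.
\<close>

lemma rk_eq_base_rk:
  assumes "u \<in> carrier A"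
  shows "rk A u = (if u = \<top>\<^bsub>A\<^esub> then rk B \<top>\<^bsub>B\<^esub> + 1 else rk B (\<pi> u))"
proof (rule A.rk_eqI[OF _ assms])
  let ?\<rho> = "\<lambda>u. if u = \<top>\<^bsub>A\<^esub> then rk B \<top>\<^bsub>B\<^esub> + 1 else rk B (\<pi> u)"
  have "?\<rho> v = ?\<rho> u + 1" if uv: "covers A u v" for u v
  proof -
    have u: "u \<in> proper"
      using uv A.le_antisym[of v "\<top>\<^bsub>A\<^esub>"] by (auto simp: covers_def A.lless_eq)
    show ?thesis
    proof (cases "v = \<top>\<^bsub>A\<^esub>")
      case True
      have "\<pi> u \<in> \<lbrace>\<pi> u..\<top>\<^bsub>B\<^esub>\<rbrace>\<^bsub>B\<^esub>"
        using u proj_closed by (auto simp: at_least_at_most_def)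
      then have "card (fibre u \<top>\<^bsub>B\<^esub>) \<noteq> 0"
        using card_fibre[OF u B.top_closed] B.finite_interval by auto
      then obtain w where w: "w \<in> fibre u \<top>\<^bsub>B\<^esub>" by (metis card.empty ex_in_conv)
      have "w = u"
      proof (rule ccontr)
        assume "w \<noteq> u"
        then have "u \<sqsubset>\<^bsub>A\<^esub> w" "w \<sqsubset>\<^bsub>A\<^esub> v" using w True by (auto simp: A.lless_eq)
        then show False using uv w by (auto simp: covers_def)
      qed
      then show ?thesis using w True by auto
    next
      case False
      then show ?thesis
        using u proj_covers[OF uv] B.is_rank_function_rk by (auto simp: is_rank_function_def)
    qed
  qed
  then show "is_rank_function A ?\<rho>"
    using bottom_neq_top proj_bottom B.is_rank_function_rk by (auto simp: is_rank_function_def)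
qed

text \<open>
  The next element of a lift is chosen in the fibre over the next element of the chain, among the
  elements above the current one. The size of that choice is a factor of the product, and it is
  the same whichever lift has been built so far.
\<close>

lemma card_chain_lifts:
  assumes "u \<in> proper" and "ys \<in> chains_from B (carrier B) (\<pi> u)"
  shows "card {c \<in> chains_from A proper u. map \<pi> c = ys} = interval_product B ys"
  using assms
proof (induction ys arbitrary: u rule: induct_list012)
  case 1
  then show ?case by (simp add: chains_from_def)
next
  case (2 y)
  then have "{c \<in> chains_from A proper u. map \<pi> c = [y]} = {[u]}"
    by (fastforce simp: chains_from_def)
  then show ?case by simp
next
  case (3 y y' ys)
  let ?lifts = "\<lambda>v. {c \<in> chains_from A proper v. map \<pi> c = y' # ys}"
  have y: "y = \<pi> u" "y' \<in> carrier B" "y \<noteq> y'"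
    using "3.prems"(2) by (auto simp: chains_from_def B.lless_eq)
  have decomp: "{c \<in> chains_from A proper u. map \<pi> c = y # y' # ys} =
    (\<Union>v\<in>fibre u y'. (#) u ` ?lifts v)" (is "?L = ?R")
  proof (intro equalityI subsetI)
    fix c assume "c \<in> ?L"
    then obtain cs where cs: "c = u # cs" "set (u # cs) \<subseteq> proper"
        "sorted_wrt (\<lambda>x y. x \<sqsubset>\<^bsub>A\<^esub> y) (u # cs)" "map \<pi> cs = y' # ys"
      unfolding chains_from_def by auto
    then obtain v c' where c': "cs = v # c'" "\<pi> v = y'" by (cases cs) auto
    have "v \<in> fibre u y'" using cs c' by (simp add: A.lless_eq)
    moreover have "cs \<in> ?lifts v" using cs c' by (simp add: chains_from_def)
    ultimately show "c \<in> ?R" unfolding cs(1) by (intro UN_I[of v] imageI)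
  next
    fix c assume "c \<in> ?R"
    then obtain v c' where v: "v \<in> fibre u y'" and c': "c' \<in> ?lifts v" and c: "c = u # c'"
      by (elim UN_E imageE)
    have lt: "u \<sqsubset>\<^bsub>A\<^esub> v" using v y by (auto simp: A.lless_eq)
    obtain c'' where c'': "c' = v # c''" "sorted_wrt (\<lambda>x y. x \<sqsubset>\<^bsub>A\<^esub> y) c'" "set c' \<subseteq> proper"
      using c' by (auto simp: chains_from_def)
    have "u \<sqsubset>\<^bsub>A\<^esub> w" if "w \<in> set c'" for w
    proof (cases "w = v")
      case False
      then show ?thesis
        using that c'' "3.prems"(1) v by (intro A.lless_trans[OF lt]) auto
    qed (use lt in simp)
    then show "c \<in> ?L"
      using c c' c'' y(1) "3.prems"(1) by (simp add: chains_from_def)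
  qed
  have "card ?L = (\<Sum>v\<in>fibre u y'. card ((#) u ` ?lifts v))"
    unfolding decomp
  proof (rule card_UN_disjoint)
    show "finite (fibre u y')" by (rule finite_fibre)
    show "\<forall>v\<in>fibre u y'. finite ((#) u ` ?lifts v)"
      using A.finite_chains_from[of proper] by auto
    show "\<forall>v\<in>fibre u y'. \<forall>w\<in>fibre u y'. v \<noteq> w \<longrightarrow> (#) u ` ?lifts v \<inter> (#) u ` ?lifts w = {}"
      unfolding chains_from_def by blast
  qed
  also have "\<dots> = (\<Sum>v\<in>fibre u y'. interval_product B (y' # ys))"
  proof (rule sum.cong[OF refl])
    fix v assume v: "v \<in> fibre u y'"
    have "y' # ys \<in> chains_from B (carrier B) (\<pi> v)"
      using "3.prems"(2) v by (auto simp: chains_from_def)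
    then have "card (?lifts v) = interval_product B (y' # ys)"
      using v by (intro "3.IH"(2)) simp_all
    then show "card ((#) u ` ?lifts v) = interval_product B (y' # ys)"
      by (simp only: card_image inj_on_Cons1)
  qed
  also have "\<dots> = card (fibre u y') * interval_product B (y' # ys)" by simp
  also have "\<dots> = interval_product B (y # y' # ys)"
    unfolding card_fibre[OF "3.prems"(1) y(2)] y(1) by simp
  finally show ?case .
qed

lemma chains_eq_append_top: "chains A = (\<lambda>c. c @ [\<top>\<^bsub>A\<^esub>]) ` chains_from A proper \<bottom>\<^bsub>A\<^esub>"
proof (intro equalityI subsetI)
  fix c assume c: "c \<in> chains A"
  then have "c \<noteq> []" "last c = \<top>\<^bsub>A\<^esub>" by (simp_all add: chains_def)
  then obtain d where cd: "c = d @ [\<top>\<^bsub>A\<^esub>]" by (cases c rule: rev_cases) simp_all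
  have d: "set d \<subseteq> carrier A" "sorted_wrt (\<lambda>x y. x \<sqsubset>\<^bsub>A\<^esub> y) d" "\<forall>x\<in>set d. x \<sqsubset>\<^bsub>A\<^esub> \<top>\<^bsub>A\<^esub>"
      "hd (d @ [\<top>\<^bsub>A\<^esub>]) = \<bottom>\<^bsub>A\<^esub>"
    using c by (simp_all add: cd chains_def sorted_wrt_append)
  obtain d' where d': "d = \<bottom>\<^bsub>A\<^esub> # d'"
    using d(4) bottom_neq_top by (cases d) simp_all
  have "set d \<subseteq> proper" using d(1,3) by (auto simp: A.lless_eq)
  then have "d \<in> chains_from A proper \<bottom>\<^bsub>A\<^esub>"
    using d(2) unfolding d' chains_from_def by blast
  then show "c \<in> (\<lambda>c. c @ [\<top>\<^bsub>A\<^esub>]) ` chains_from A proper \<bottom>\<^bsub>A\<^esub>"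
    unfolding cd by (rule imageI)
next
  fix c assume "c \<in> (\<lambda>c. c @ [\<top>\<^bsub>A\<^esub>]) ` chains_from A proper \<bottom>\<^bsub>A\<^esub>"
  then obtain d where c: "c = (\<bottom>\<^bsub>A\<^esub> # d) @ [\<top>\<^bsub>A\<^esub>]" and d: "set (\<bottom>\<^bsub>A\<^esub> # d) \<subseteq> proper"
      "sorted_wrt (\<lambda>x y. x \<sqsubset>\<^bsub>A\<^esub> y) (\<bottom>\<^bsub>A\<^esub> # d)"
    unfolding chains_from_def by blast
  have "\<forall>x\<in>set (\<bottom>\<^bsub>A\<^esub> # d). x \<sqsubset>\<^bsub>A\<^esub> \<top>\<^bsub>A\<^esub>"
    using d(1) by (auto simp: A.lless_eq)
  then have "sorted_wrt (\<lambda>x y. x \<sqsubset>\<^bsub>A\<^esub> y) c"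
    unfolding c sorted_wrt_append using d(2) by simp
  moreover have "set c \<subseteq> carrier A" using d(1) unfolding c by auto
  ultimately show "c \<in> chains A" unfolding chains_def c by simp
qed

text \<open>
  The weight of a chain depends only on its ranks, hence only on the projected chain, so the sum
  over the chains of \<open>A\<close> can be grouped by their projections.
\<close>

theorem ab_index_eq_interval_chain_sum: "\<Psi> A = interval_chain_sum B"
proof -
  let ?C = "chains_from A proper \<bottom>\<^bsub>A\<^esub>" and ?D = "chains_from B (carrier B) \<bottom>\<^bsub>B\<^esub>"
  let ?w = "\<lambda>ys. wt id (map (rk B) ys @ [rk B \<top>\<^bsub>B\<^esub> + 1])"
  have wt: "wt (rk A) (c @ [\<top>\<^bsub>A\<^esub>]) = ?w (map \<pi> c)" if "c \<in> ?C" for c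
  proof -
    have "map (rk A) c = map (rk B) (map \<pi> c)"
    proof -
      have "set c \<subseteq> proper" using that unfolding chains_from_def by blast
      then have "rk A x = rk B (\<pi> x)" if "x \<in> set c" for x
        using rk_eq_base_rk[of x] that by (metis DiffE singletonI subsetD)
      then show ?thesis by simp
    qed
    moreover have "rk A \<top>\<^bsub>A\<^esub> = rk B \<top>\<^bsub>B\<^esub> + 1" by (simp add: rk_eq_base_rk)
    ultimately show ?thesis by (simp only: wt_map[of "rk A"] map_append list.map)
  qed
  have proj: "map \<pi> ` ?C \<subseteq> ?D"
  proof
    fix ys assume "ys \<in> map \<pi> ` ?C"
    then obtain c where ys: "ys = map \<pi> (\<bottom>\<^bsub>A\<^esub> # c)" and c: "set (\<bottom>\<^bsub>A\<^esub> # c) \<subseteq> proper"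
        "sorted_wrt (\<lambda>x y. x \<sqsubset>\<^bsub>A\<^esub> y) (\<bottom>\<^bsub>A\<^esub> # c)"
      unfolding chains_from_def by blast
    have "sorted_wrt (\<lambda>x y. \<pi> x \<sqsubset>\<^bsub>B\<^esub> \<pi> y) (\<bottom>\<^bsub>A\<^esub> # c)"
      by (rule sorted_wrt_mono_rel[OF _ c(2)]) (use c(1) proj_strict_mono in blast)
    then have "sorted_wrt (\<lambda>x y. x \<sqsubset>\<^bsub>B\<^esub> y) ys" unfolding ys sorted_wrt_map .
    moreover have "set ys \<subseteq> carrier B" unfolding ys set_map using c(1) proj_closed by blast
    ultimately show "ys \<in> ?D" unfolding ys chains_from_def proj_bottom[symmetric] by simp
  qed
  have "\<Psi> A = (\<Sum>c\<in>?C. ?w (map \<pi> c))"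
    unfolding ab_index_def chains_eq_append_top
    by (subst sum.reindex) (auto simp: inj_on_def wt)
  also have "\<dots> = (\<Sum>ys\<in>?D. \<Sum>c\<in>{c \<in> ?C. map \<pi> c = ys}. ?w (map \<pi> c))"
    by (rule sum.group[symmetric])
      (use proj A.finite_chains_from[of proper] B.finite_chains_from in auto)
  also have "\<dots> = (\<Sum>ys\<in>?D. of_nat (interval_product B ys) * ?w ys)"
  proof (rule sum.cong[OF refl])
    fix ys assume ys: "ys \<in> ?D"
    have "(\<Sum>c\<in>{c \<in> ?C. map \<pi> c = ys}. ?w (map \<pi> c)) = (\<Sum>c\<in>{c \<in> ?C. map \<pi> c = ys}. ?w ys)"
      by (rule sum.cong) auto
    then show "(\<Sum>c\<in>{c \<in> ?C. map \<pi> c = ys}. ?w (map \<pi> c)) = of_nat (interval_product B ys) * ?w ys"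
      using card_chain_lifts[OF bottom_proper] ys proj_bottom by simp
  qed
  finally show ?thesis unfolding interval_chain_sum_def .
qed

end


section \<open>Cartesian products and the dual diamond product\<close>

lemma carrier_poset_prod [simp]: "carrier (P \<times>\<^sub>p Q) = carrier P \<times> carrier Q"
  by (simp add: poset_prod_def)

lemma le_poset_prod [simp]:
  "(x, y) \<sqsubseteq>\<^bsub>P \<times>\<^sub>p Q\<^esub> (x', y') \<longleftrightarrow> x \<sqsubseteq>\<^bsub>P\<^esub> x' \<and> y \<sqsubseteq>\<^bsub>Q\<^esub> y'"
  by (simp add: poset_prod_def)

lemma lless_poset_prod:
  "u \<sqsubset>\<^bsub>P \<times>\<^sub>p Q\<^esub> v \<longleftrightarrow> u \<sqsubseteq>\<^bsub>P \<times>\<^sub>p Q\<^esub> v \<and> u \<noteq> v"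
  by (simp add: lless_def poset_prod_def)

lemma interval_poset_prod:
  "\<lbrace>(x, y)..(x', y')\<rbrace>\<^bsub>P \<times>\<^sub>p Q\<^esub> = \<lbrace>x..x'\<rbrace>\<^bsub>P\<^esub> \<times> \<lbrace>y..y'\<rbrace>\<^bsub>Q\<^esub>"
  by (auto simp: at_least_at_most_def)

text \<open>
  A cover changes one coordinate only: from \<open>(x, y) < (x', y')\<close> the element \<open>(x', y)\<close> would otherwise
  lie strictly between.
\<close>

lemma covers_poset_prod:
  assumes "partial_order P" "partial_order Q"
  shows "covers (P \<times>\<^sub>p Q) (x, y) (x', y') \<longleftrightarrow>
    covers P x x' \<and> y = y' \<and> y \<in> carrier Q \<or> x = x' \<and> x \<in> carrier P \<and> covers Q y y'"
    (is "?L \<longleftrightarrow> ?R")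
proof -
  interpret P: partial_order P by fact
  interpret Q: partial_order Q by fact
  show ?thesis
  proof
    assume L: ?L
    then have c: "x \<in> carrier P" "x' \<in> carrier P" "y \<in> carrier Q" "y' \<in> carrier Q"
      and le: "x \<sqsubseteq>\<^bsub>P\<^esub> x'" "y \<sqsubseteq>\<^bsub>Q\<^esub> y'" and ne: "(x, y) \<noteq> (x', y')"
      by (auto simp: covers_def lless_poset_prod)
    have nob: "\<And>z. z \<in> carrier (P \<times>\<^sub>p Q) \<Longrightarrow> (x, y) \<sqsubseteq>\<^bsub>P \<times>\<^sub>p Q\<^esub> z \<Longrightarrow> z \<sqsubseteq>\<^bsub>P \<times>\<^sub>p Q\<^esub> (x', y') \<Longrightarrow>
        z = (x, y) \<or> z = (x', y')"
      using L unfolding covers_def lless_poset_prod by blast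
    from nob[of "(x', y)"] c le have "x = x' \<or> y = y'" by auto
    then show ?R
    proof
      assume "x = x'"
      with ne c le nob[of "(x, z)" for z] show ?R
        by (auto simp: covers_def Q.lless_eq)
    next
      assume "y = y'"
      with ne c le nob[of "(z, y)" for z] show ?R
        by (auto simp: covers_def P.lless_eq)
    qed
  next
    assume ?R
    then show ?L
    proof (elim disjE conjE)
      assume xx': "covers P x x'" and "y = y'" "y \<in> carrier Q"
      have "z = (x, y) \<or> z = (x', y)"
        if "z \<in> carrier (P \<times>\<^sub>p Q)" "(x, y) \<sqsubseteq>\<^bsub>P \<times>\<^sub>p Q\<^esub> z" "z \<sqsubseteq>\<^bsub>P \<times>\<^sub>p Q\<^esub> (x', y)" for z
        using that xx' Q.le_antisym[of "snd z" y] \<open>y \<in> carrier Q\<close>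
        by (cases z) (auto simp: covers_def P.lless_eq)
      then have "\<nexists>z. z \<in> carrier (P \<times>\<^sub>p Q) \<and> (x, y) \<sqsubset>\<^bsub>P \<times>\<^sub>p Q\<^esub> z \<and> z \<sqsubset>\<^bsub>P \<times>\<^sub>p Q\<^esub> (x', y)"
        unfolding lless_poset_prod by blast
      moreover have "(x, y) \<sqsubset>\<^bsub>P \<times>\<^sub>p Q\<^esub> (x', y)"
        using xx' \<open>y = y'\<close> \<open>y \<in> carrier Q\<close> by (simp add: lless_poset_prod covers_def P.lless_eq)
      ultimately show ?L
        using xx' \<open>y = y'\<close> \<open>y \<in> carrier Q\<close> by (simp add: covers_def)
    next
      assume yy': "covers Q y y'" and "x = x'" "x \<in> carrier P"
      have "z = (x, y) \<or> z = (x, y')"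
        if "z \<in> carrier (P \<times>\<^sub>p Q)" "(x, y) \<sqsubseteq>\<^bsub>P \<times>\<^sub>p Q\<^esub> z" "z \<sqsubseteq>\<^bsub>P \<times>\<^sub>p Q\<^esub> (x, y')" for z
        using that yy' P.le_antisym[of "fst z" x] \<open>x \<in> carrier P\<close>
        by (cases z) (auto simp: covers_def Q.lless_eq)
      then have "\<nexists>z. z \<in> carrier (P \<times>\<^sub>p Q) \<and> (x, y) \<sqsubset>\<^bsub>P \<times>\<^sub>p Q\<^esub> z \<and> z \<sqsubset>\<^bsub>P \<times>\<^sub>p Q\<^esub> (x, y')"
        unfolding lless_poset_prod by blast
      moreover have "(x, y) \<sqsubset>\<^bsub>P \<times>\<^sub>p Q\<^esub> (x, y')"
        using yy' \<open>x = x'\<close> \<open>x \<in> carrier P\<close> by (simp add: lless_poset_prod covers_def Q.lless_eq)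
      ultimately show ?L
        using yy' \<open>x = x'\<close> \<open>x \<in> carrier P\<close> by (simp add: covers_def)
    qed
  qed
qed

lemma graded_poset_prod:
  assumes "graded_poset P" "graded_poset Q"
  shows "graded_poset (P \<times>\<^sub>p Q)" and "\<bottom>\<^bsub>P \<times>\<^sub>p Q\<^esub> = (\<bottom>\<^bsub>P\<^esub>, \<bottom>\<^bsub>Q\<^esub>)"
proof -
  interpret P: graded_poset P by fact
  interpret Q: graded_poset Q by fact
  have po: "partial_order (P \<times>\<^sub>p Q)"
    by (rule partial_orderI) (auto simp: poset_prod_def intro: P.le_trans Q.le_trans P.le_antisym Q.le_antisym)
  have least: "least (P \<times>\<^sub>p Q) (\<bottom>\<^bsub>P\<^esub>, \<bottom>\<^bsub>Q\<^esub>) (carrier (P \<times>\<^sub>p Q))"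
    and greatest: "greatest (P \<times>\<^sub>p Q) (\<top>\<^bsub>P\<^esub>, \<top>\<^bsub>Q\<^esub>) (carrier (P \<times>\<^sub>p Q))"
    by (auto simp: least_def greatest_def)
  interpret R: finite_bounded_poset "P \<times>\<^sub>p Q"
    by (intro finite_bounded_poset.intro po finite_bounded_poset_axioms.intro)
      (use least greatest P.finite_carrier Q.finite_carrier in auto)
  show bot: "\<bottom>\<^bsub>P \<times>\<^sub>p Q\<^esub> = (\<bottom>\<^bsub>P\<^esub>, \<bottom>\<^bsub>Q\<^esub>)"
    by (rule R.bottom_eqI[OF least])
  have "is_rank_function (P \<times>\<^sub>p Q) (\<lambda>(x, y). rk P x + rk Q y)"
    using P.is_rank_function_rk Q.is_rank_function_rk
    by (auto simp: is_rank_function_def bot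
        covers_poset_prod[OF P.partial_order_axioms Q.partial_order_axioms])
  then show "graded_poset (P \<times>\<^sub>p Q)"
    by (intro graded_poset.intro po graded_poset_axioms.intro)
      (use R.finite_carrier R.least_exists R.greatest_exists in auto)
qed

lemma carrier_dual_diamond [simp]:
  "carrier (P \<diamondop>\<^sup>* Q) = insert None (Some ` ((carrier P - {\<top>\<^bsub>P\<^esub>}) \<times> (carrier Q - {\<top>\<^bsub>Q\<^esub>})))"
  by (simp add: dual_diamond_def adjoin_top_def remove_top_def)

lemma le_dual_diamond [simp]:
  "u \<sqsubseteq>\<^bsub>P \<diamondop>\<^sup>* Q\<^esub> None"
  "\<not> None \<sqsubseteq>\<^bsub>P \<diamondop>\<^sup>* Q\<^esub> Some p"
  "Some (x, y) \<sqsubseteq>\<^bsub>P \<diamondop>\<^sup>* Q\<^esub> Some (x', y') \<longleftrightarrow> x \<sqsubseteq>\<^bsub>P\<^esub> x' \<and> y \<sqsubseteq>\<^bsub>Q\<^esub> y'"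
  by (auto simp: dual_diamond_def adjoin_top_def remove_top_def poset_prod_def split: option.split)

lemma lless_dual_diamond: "u \<sqsubset>\<^bsub>P \<diamondop>\<^sup>* Q\<^esub> v \<longleftrightarrow> u \<sqsubseteq>\<^bsub>P \<diamondop>\<^sup>* Q\<^esub> v \<and> u \<noteq> v"
  by (simp add: lless_def dual_diamond_def adjoin_top_def)

text \<open>
  Away from the tops, both the fibre above an element and the interval in the base are products
  of those of the factors. A cover changes one coordinate only, for the same reason as in a
  Cartesian product.
\<close>

lemma interval_fibration_dual_diamond:
  assumes "interval_fibration A B \<pi>" "interval_fibration A' B' \<pi>'"
  shows "interval_fibration (A \<diamondop>\<^sup>* A') (B \<times>\<^sub>p B') (map_prod \<pi> \<pi>' \<circ> the)"
proof -
  interpret F: interval_fibration A B \<pi> by fact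
  interpret F': interval_fibration A' B' \<pi>' by fact
  let ?D = "A \<diamondop>\<^sup>* A'"
  have po: "partial_order ?D"
  proof (rule partial_orderI)
    show "eq ?D = (=)" by (simp add: dual_diamond_def adjoin_top_def)
    show "x = y" if "x \<in> carrier ?D" "y \<in> carrier ?D" "x \<sqsubseteq>\<^bsub>?D\<^esub> y" "y \<sqsubseteq>\<^bsub>?D\<^esub> x" for x y
      using that by (auto intro: F.A.le_antisym F'.A.le_antisym)
    show "x \<sqsubseteq>\<^bsub>?D\<^esub> z" if "x \<in> carrier ?D" "y \<in> carrier ?D" "z \<in> carrier ?D"
      "x \<sqsubseteq>\<^bsub>?D\<^esub> y" "y \<sqsubseteq>\<^bsub>?D\<^esub> z" for x y z
      using that by (auto intro: F.A.le_trans F'.A.le_trans)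
  qed auto
  have least: "least ?D (Some (\<bottom>\<^bsub>A\<^esub>, \<bottom>\<^bsub>A'\<^esub>)) (carrier ?D)"
    and greatest: "greatest ?D None (carrier ?D)"
    using F.bottom_neq_top F'.bottom_neq_top by (auto simp: least_def greatest_def)
  interpret D: finite_bounded_poset ?D
    by (intro finite_bounded_poset.intro po finite_bounded_poset_axioms.intro)
      (use least greatest F.A.finite_carrier F'.A.finite_carrier in auto)
  interpret BB: graded_poset "B \<times>\<^sub>p B'"
    by (rule graded_poset_prod; unfold_locales)
  have bot: "\<bottom>\<^bsub>?D\<^esub> = Some (\<bottom>\<^bsub>A\<^esub>, \<bottom>\<^bsub>A'\<^esub>)" and top: "\<top>\<^bsub>?D\<^esub> = None"
    by (rule D.bottom_eqI[OF least], rule D.top_eqI[OF greatest])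
  show ?thesis
  proof
    show "\<bottom>\<^bsub>?D\<^esub> \<noteq> \<top>\<^bsub>?D\<^esub>" by (simp add: bot top)
    show "(map_prod \<pi> \<pi>' \<circ> the) \<bottom>\<^bsub>?D\<^esub> = \<bottom>\<^bsub>B \<times>\<^sub>p B'\<^esub>"
      by (simp add: bot graded_poset_prod(2)[OF F.B.graded_poset_axioms F'.B.graded_poset_axioms]
          F.proj_bottom F'.proj_bottom)
    show "(map_prod \<pi> \<pi>' \<circ> the) u \<in> carrier (B \<times>\<^sub>p B')" if "u \<in> carrier ?D - {\<top>\<^bsub>?D\<^esub>}" for u
      using that by (auto simp: top intro!: F.proj_closed F'.proj_closed)
  next
    fix u v assume uv: "covers ?D u v" and "v \<noteq> \<top>\<^bsub>?D\<^esub>"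
    then obtain x x' y y' where eqs: "u = Some (x, x')" "v = Some (y, y')"
      by (cases u; cases v) (auto simp: covers_def top lless_dual_diamond)
    have c: "x \<in> F.proper" "y \<in> F.proper" "x' \<in> F'.proper" "y' \<in> F'.proper"
      and le: "x \<sqsubseteq>\<^bsub>A\<^esub> y" "x' \<sqsubseteq>\<^bsub>A'\<^esub> y'" and ne: "(x, x') \<noteq> (y, y')"
      using uv by (auto simp: covers_def eqs lless_dual_diamond)
    have nob: "(z, z') = (x, x') \<or> (z, z') = (y, y')"
      if "z \<in> F.proper" "z' \<in> F'.proper" "x \<sqsubseteq>\<^bsub>A\<^esub> z" "z \<sqsubseteq>\<^bsub>A\<^esub> y" "x' \<sqsubseteq>\<^bsub>A'\<^esub> z'" "z' \<sqsubseteq>\<^bsub>A'\<^esub> y'"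
      for z z'
    proof -
      have "\<not> (Some (z, z') \<in> carrier ?D \<and> u \<sqsubset>\<^bsub>?D\<^esub> Some (z, z') \<and> Some (z, z') \<sqsubset>\<^bsub>?D\<^esub> v)"
        using uv unfolding covers_def by blast
      then show ?thesis
        using that by (auto simp: eqs lless_dual_diamond)
    qed
    have "x = y \<or> x' = y'" using nob[of y x'] c le by auto
    then have "covers A x y \<and> x' = y' \<or> x = y \<and> covers A' x' y'"
    proof
      assume eq: "x = y"
      have "z = x' \<or> z = y'"
        if "z \<in> carrier A'" "x' \<sqsubseteq>\<^bsub>A'\<^esub> z" "z \<sqsubseteq>\<^bsub>A'\<^esub> y'" for z
      proof -
        (* Below a proper element there are only proper ones, so z occurs in the product. *)
        have "z \<noteq> \<top>\<^bsub>A'\<^esub>" using that c by (auto dest: F'.A.le_antisym)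
        then show ?thesis using nob[of x z] that c eq by auto
      qed
      then show ?thesis using c le ne eq by (auto simp: covers_def F'.A.lless_eq)
    next
      assume eq: "x' = y'"
      have "z = x \<or> z = y"
        if "z \<in> carrier A" "x \<sqsubseteq>\<^bsub>A\<^esub> z" "z \<sqsubseteq>\<^bsub>A\<^esub> y" for z
      proof -
        have "z \<noteq> \<top>\<^bsub>A\<^esub>" using that c by (auto dest: F.A.le_antisym)
        then show ?thesis using nob[of z x'] that c eq by auto
      qed
      then show ?thesis using c le ne eq by (auto simp: covers_def F.A.lless_eq)
    qed
    then show "covers (B \<times>\<^sub>p B') ((map_prod \<pi> \<pi>' \<circ> the) u) ((map_prod \<pi> \<pi>' \<circ> the) v)"
      using c F.proj_covers F'.proj_covers F.proj_closed F'.proj_closed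
      by (auto simp: eqs
          covers_poset_prod[OF F.B.partial_order_axioms F'.B.partial_order_axioms])
  next
    fix u y assume u: "u \<in> carrier ?D - {\<top>\<^bsub>?D\<^esub>}" and y: "y \<in> carrier (B \<times>\<^sub>p B')"
    obtain x x' where u': "u = Some (x, x')" "x \<in> F.proper" "x' \<in> F'.proper"
      using u by (auto simp: top)
    obtain z z' where y': "y = (z, z')" "z \<in> carrier B" "z' \<in> carrier B'" using y by auto
    have "{v \<in> carrier ?D - {\<top>\<^bsub>?D\<^esub>}. u \<sqsubseteq>\<^bsub>?D\<^esub> v \<and> (map_prod \<pi> \<pi>' \<circ> the) v = y} =
      Some ` (F.fibre x z \<times> F'.fibre x' z')"
      by (auto simp: u' y' top)
    then show "card {v \<in> carrier ?D - {\<top>\<^bsub>?D\<^esub>}. u \<sqsubseteq>\<^bsub>?D\<^esub> v \<and> (map_prod \<pi> \<pi>' \<circ> the) v = y} =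
      card \<lbrace>(map_prod \<pi> \<pi>' \<circ> the) u..y\<rbrace>\<^bsub>B \<times>\<^sub>p B'\<^esub>"
      using F.card_fibre[OF u'(2) y'(2)] F'.card_fibre[OF u'(3) y'(3)]
      by (simp add: card_image u' y' interval_poset_prod card_cartesian_product)
  qed
qed


section \<open>The Tchebyshev transform\<close>

lemma carrier_adjoin_bottom [simp]: "carrier (adjoin_bottom P) = insert None (Some ` carrier P)"
  by (simp add: adjoin_bottom_def)

lemma le_adjoin_bottom [simp]:
  "None \<sqsubseteq>\<^bsub>adjoin_bottom P\<^esub> v"
  "\<not> Some x \<sqsubseteq>\<^bsub>adjoin_bottom P\<^esub> None"
  "Some x \<sqsubseteq>\<^bsub>adjoin_bottom P\<^esub> Some y \<longleftrightarrow> x \<sqsubseteq>\<^bsub>P\<^esub> y"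
  by (auto simp: adjoin_bottom_def)

lemma lless_adjoin_bottom:
  "u \<sqsubset>\<^bsub>adjoin_bottom P\<^esub> v \<longleftrightarrow> u \<sqsubseteq>\<^bsub>adjoin_bottom P\<^esub> v \<and> u \<noteq> v"
  by (simp add: lless_def adjoin_bottom_def)

lemma covers_adjoin_bottom_Some:
  assumes "partial_order P"
  shows "covers (adjoin_bottom P) (Some x) v \<longleftrightarrow> (\<exists>y. v = Some y \<and> covers P x y)"
proof -
  interpret partial_order P by fact
  show ?thesis
    by (cases v) (simp_all add: covers_def lless_adjoin_bottom lless_eq split_option_ex image_iff)
qed

context graded_poset
begin

abbreviation "P0 \<equiv> adjoin_bottom P"
abbreviation "T \<equiv> tchebyshev P"

lemma partial_order_adjoin_bottom: "partial_order P0"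
proof (rule partial_orderI)
  show "eq P0 = (=)" by (simp add: adjoin_bottom_def)
  show "x \<sqsubseteq>\<^bsub>P0\<^esub> z" if "x \<in> carrier P0" "y \<in> carrier P0" "z \<in> carrier P0"
    "x \<sqsubseteq>\<^bsub>P0\<^esub> y" "y \<sqsubseteq>\<^bsub>P0\<^esub> z" for x y z
    using that by (cases x; cases y; cases z) (auto intro: le_trans)
qed (auto intro: le_antisym)

sublocale P0: partial_order P0 by (rule partial_order_adjoin_bottom)

lemma intervals_iff:
  "(x, y) \<in> intervals P \<longleftrightarrow> x \<in> carrier P0 \<and> (\<exists>y'\<in>carrier P. y = Some y') \<and> x \<sqsubseteq>\<^bsub>P0\<^esub> y \<and> x \<noteq> y"
  by (cases y) (auto simp: intervals_def lless_adjoin_bottom)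

lemma carrier_tchebyshev [simp]: "carrier T = insert None (Some ` intervals P)"
  by (simp add: tchebyshev_def)

lemma lless_tchebyshev: "u \<sqsubset>\<^bsub>T\<^esub> v \<longleftrightarrow> u \<sqsubseteq>\<^bsub>T\<^esub> v \<and> u \<noteq> v"
  by (simp add: lless_def tchebyshev_def)

lemma intervalsD:
  assumes "(x, y) \<in> intervals P"
  shows "x \<in> carrier P0" "y \<in> carrier P0" "x \<sqsubseteq>\<^bsub>P0\<^esub> y" "x \<noteq> y"
  using assms by (simp_all add: intervals_def lless_adjoin_bottom del: carrier_adjoin_bottom)

lemma covers_P0D:
  assumes "covers P0 x y"
  shows "x \<in> carrier P0" "y \<in> carrier P0" "x \<sqsubseteq>\<^bsub>P0\<^esub> y" "(x, y) \<in> intervals P"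
  using assms
  by (simp_all add: covers_def intervals_def lless_adjoin_bottom del: carrier_adjoin_bottom)

lemma P0_path: "x \<in> carrier P0 \<Longrightarrow> y \<in> carrier P0 \<Longrightarrow> x \<sqsubseteq>\<^bsub>P0\<^esub> y \<Longrightarrow> (covers P0)\<^sup>*\<^sup>* x y"
  using finite_carrier by (intro covers_path partial_order_adjoin_bottom) auto

lemma extend_le_tchebyshev:
  assumes xy: "(x, y) \<in> intervals P" and y': "y' \<in> carrier P0" "y \<sqsubseteq>\<^bsub>P0\<^esub> y'"
  shows "(x, y') \<in> intervals P \<and> Some (x, y) \<sqsubseteq>\<^bsub>T\<^esub> Some (x, y')"
proof -
  have "(covers P0)\<^sup>*\<^sup>* y y'"
    using assms by (intro P0_path) (auto simp: intervals_iff)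
  then have "(x, y') \<in> intervals P \<and> (tchebyshev_cover P)\<^sup>*\<^sup>* (Some (x, y)) (Some (x, y'))"
  proof induction
    case (step z w)
    then have "(x, w) \<in> intervals P"
      by (auto simp: covers_def intervals_def dest: P0.lless_trans)
    moreover have "tchebyshev_cover P (Some (x, z)) (Some (x, w))"
      using step by (intro tchebyshev_cover.extend) auto
    ultimately show ?case using step.IH by (meson rtranclp.rtrancl_into_rtrancl)
  qed (use xy in auto)
  then show ?thesis by (simp add: tchebyshev_def)
qed

text \<open>
  The order is generated by cover relations. To reach \<open>[x', y']\<close> with \<open>x'\<close> above \<open>y\<close>, extend
  \<open>[x, y]\<close> to \<open>[x, x']\<close>, shift to \<open>[x', w]\<close> where \<open>w\<close> covers \<open>x'\<close> on the way to \<open>y'\<close>, and extend to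
  \<open>[x', y']\<close>. Conversely, the first shift on a path moves the left end to an element above
  \<open>y\<close>, where it stays; a path without shifts keeps the left end.
\<close>

lemma le_tchebyshev_Some:
  assumes xy: "(x, y) \<in> intervals P"
  shows "Some (x, y) \<sqsubseteq>\<^bsub>T\<^esub> Some (x', y') \<longleftrightarrow>
    (x', y') \<in> intervals P \<and> (x = x' \<and> y \<sqsubseteq>\<^bsub>P0\<^esub> y' \<or> y \<sqsubseteq>\<^bsub>P0\<^esub> x')"
    (is "?L \<longleftrightarrow> ?R")
proof
  assume ?L
  then have "(tchebyshev_cover P)\<^sup>*\<^sup>* (Some (x, y)) (Some (x', y'))"
    by (simp add: tchebyshev_def)
  then show ?R
  proof (induction "Some (x', y')" arbitrary: x' y')
    case base
    then show ?case using xy by (auto simp: intervals_iff)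
  next
    case (step u)
    from \<open>tchebyshev_cover P u (Some (x', y'))\<close> show ?case
    proof cases
      case (shift a)
      have "y \<sqsubseteq>\<^bsub>P0\<^esub> x'"
        using step(3)[OF shift(1)]
      proof (elim conjE disjE)
        assume "(a, x') \<in> intervals P" "y \<sqsubseteq>\<^bsub>P0\<^esub> a"
        then show ?thesis
          using P0.le_trans[of y a x'] intervalsD(2)[OF xy] by (blast dest: intervalsD)
      qed
      with covers_P0D(4)[OF shift(3)] show ?thesis by blast
    next
      case (extend b)
      note b = covers_P0D[OF extend(3)]
      have "y \<sqsubseteq>\<^bsub>P0\<^esub> b \<Longrightarrow> y \<sqsubseteq>\<^bsub>P0\<^esub> y'"
        using P0.le_trans[of y b y'] intervalsD(2)[OF xy] b by blast
      moreover have "(x', y') \<in> intervals P"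
        using extend_le_tchebyshev[OF extend(2) b(2,3)] by blast
      ultimately show ?thesis using step(3)[OF extend(1)] by blast
    qed
  qed
next
  assume R: ?R
  then have x'y': "(x', y') \<in> intervals P" by blast
  note c = intervalsD[OF x'y']
  show ?L
  proof (cases "x = x' \<and> y \<sqsubseteq>\<^bsub>P0\<^esub> y'")
    case True
    then show ?thesis using extend_le_tchebyshev[OF xy c(2)] by blast
  next
    case False
    then have yx': "y \<sqsubseteq>\<^bsub>P0\<^esub> x'" using R by blast
    have ext: "(x, x') \<in> intervals P" "Some (x, y) \<sqsubseteq>\<^bsub>T\<^esub> Some (x, x')"
      using extend_le_tchebyshev[OF xy c(1) yx'] by blast+
    obtain w where w: "covers P0 x' w" "(covers P0)\<^sup>*\<^sup>* w y'"
      using P0_path[OF c(1-3)] by (rule converse_rtranclpE) (use c(4) in blast)+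
    note cw = covers_P0D[OF w(1)]
    from w(2) have "w \<sqsubseteq>\<^bsub>P0\<^esub> y'"
    proof induction
      case (step z v)
      then show ?case using covers_P0D[OF step(2)] P0.le_trans[of w z v] cw(2) by blast
    qed (use cw in blast)
    then have "Some (x', w) \<sqsubseteq>\<^bsub>T\<^esub> Some (x', y')"
      using extend_le_tchebyshev[OF cw(4) c(2)] by blast
    moreover have "tchebyshev_cover P (Some (x, x')) (Some (x', w))"
      using ext(1) w(1) by (rule tchebyshev_cover.shift)
    ultimately show ?thesis
      using ext(2) by (simp add: tchebyshev_def)
  qed
qed

lemma le_tchebyshev_None: "u \<in> carrier T \<Longrightarrow> u \<sqsubseteq>\<^bsub>T\<^esub> None"
proof -
  assume "u \<in> carrier T"
  then consider "u = None" | x y where "u = Some (x, y)" "(x, y) \<in> intervals P" by auto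
  then show ?thesis
  proof cases
    case 1
    then show ?thesis by (simp add: tchebyshev_def)
  next
    case 2
    have "y \<sqsubseteq>\<^bsub>P0\<^esub> Some \<top>" using 2 by (auto simp: intervals_iff)
    then have "(x, Some \<top>) \<in> intervals P" "u \<sqsubseteq>\<^bsub>T\<^esub> Some (x, Some \<top>)"
      using extend_le_tchebyshev[OF 2(2), of "Some \<top>"] 2 by auto
    then show ?thesis
      by (auto simp: tchebyshev_def intro: tchebyshev_cover.top rtranclp.rtrancl_into_rtrancl)
  qed
qed

lemma None_le_tchebyshev: "None \<sqsubseteq>\<^bsub>T\<^esub> u \<longleftrightarrow> u = None"
  by (auto simp: tchebyshev_def elim: converse_rtranclpE tchebyshev_cover.cases)

lemma finite_bounded_poset_tchebyshev:
  shows "finite_bounded_poset T" and "\<bottom>\<^bsub>T\<^esub> = Some (None, Some \<bottom>)" and "\<top>\<^bsub>T\<^esub> = None"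
proof -
  have po: "partial_order T"
  proof (rule partial_orderI)
    show "eq T = (=)" by (simp add: tchebyshev_def)
    show "x \<sqsubseteq>\<^bsub>T\<^esub> x" for x by (simp add: tchebyshev_def)
    show "x \<sqsubseteq>\<^bsub>T\<^esub> z" if "x \<sqsubseteq>\<^bsub>T\<^esub> y" "y \<sqsubseteq>\<^bsub>T\<^esub> z" for x y z
      using that by (auto simp: tchebyshev_def)
    show "u = v" if "u \<in> carrier T" "v \<in> carrier T" "u \<sqsubseteq>\<^bsub>T\<^esub> v" "v \<sqsubseteq>\<^bsub>T\<^esub> u" for u v
    proof (cases "u = None \<or> v = None")
      case True
      then show ?thesis using that by (auto simp: None_le_tchebyshev)
    next
      case False
      then obtain x y x' y' where eqs: "u = Some (x, y)" "v = Some (x', y')" by auto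
      have iv: "(x, y) \<in> intervals P" "(x', y') \<in> intervals P"
        using that by (auto simp: eqs)
      have lt: "x \<sqsubset>\<^bsub>P0\<^esub> y" "x' \<sqsubset>\<^bsub>P0\<^esub> y'"
        and c: "x \<in> carrier P0" "y \<in> carrier P0" "x' \<in> carrier P0" "y' \<in> carrier P0"
        using iv unfolding intervals_def by blast+
      have "x = x' \<and> y \<sqsubseteq>\<^bsub>P0\<^esub> y' \<or> y \<sqsubseteq>\<^bsub>P0\<^esub> x'" "x' = x \<and> y' \<sqsubseteq>\<^bsub>P0\<^esub> y \<or> y' \<sqsubseteq>\<^bsub>P0\<^esub> x"
        using that iv by (auto simp: eqs le_tchebyshev_Some)
      then show ?thesis
        using lt c unfolding eqs P0.lless_eq
        by (metis P0.le_antisym P0.le_trans)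
    qed
  qed
  have "Some (None, Some \<bottom>) \<sqsubseteq>\<^bsub>T\<^esub> u" if u: "u \<in> carrier T" for u
  proof (cases u)
    case None
    then show ?thesis by (auto intro: le_tchebyshev_None simp: intervals_iff)
  next
    case (Some p)
    obtain x y where p: "p = (x, y)" by (cases p)
    have "(x, y) \<in> intervals P" using u Some p by auto
    then show ?thesis
      unfolding Some p by (subst le_tchebyshev_Some) (auto simp: intervals_iff)
  qed
  then have least: "least T (Some (None, Some \<bottom>)) (carrier T)"
    by (auto simp: least_def intervals_iff)
  have greatest: "greatest T None (carrier T)"
    using le_tchebyshev_None by (auto simp: greatest_def)
  have "finite (intervals P)"
    by (rule finite_subset[of _ "carrier P0 \<times> carrier P0"])
      (use finite_carrier in \<open>auto simp: intervals_def\<close>)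
  then show fbp: "finite_bounded_poset T"
    by (intro finite_bounded_poset.intro po finite_bounded_poset_axioms.intro)
      (use least greatest in auto)
  show "\<bottom>\<^bsub>T\<^esub> = Some (None, Some \<bottom>)" "\<top>\<^bsub>T\<^esub> = None"
    by (rule finite_bounded_poset.bottom_eqI[OF fbp least],
        rule finite_bounded_poset.top_eqI[OF fbp greatest])
qed

text \<open>
  A cover of the generated order is reached by a path of generating relations, whose first step is
  strict and so already ends at the upper element. This is the inclusion that determines ranks,
  as the generating relations advance the right end by one cover.
\<close>

lemma covers_tchebyshev:
  assumes uv: "covers T u v"
  shows "tchebyshev_cover P u v"
proof -
  have "u \<sqsubseteq>\<^bsub>T\<^esub> v" "u \<noteq> v"
    using uv by (simp_all add: covers_def lless_tchebyshev)
  then obtain w where w: "tchebyshev_cover P u w" "(tchebyshev_cover P)\<^sup>*\<^sup>* w v"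
    unfolding tchebyshev_def by (metis (no_types, lifting) converse_rtranclpE gorder.select_convs(1))
  have "w \<in> carrier T \<and> u \<noteq> w"
    using w(1)
  proof cases
    case (shift x y z)
    then show ?thesis using intervalsD(4)[OF shift(3)] covers_P0D(4)[OF shift(4)] by simp
  next
    case (extend x y z)
    note z = covers_P0D[OF extend(4)]
    show ?thesis
      using extend_le_tchebyshev[OF extend(3) z(2,3)] intervalsD(4)[OF z(4)] extend(1,2) by simp
  qed simp
  moreover have "u \<sqsubset>\<^bsub>T\<^esub> w \<and> w \<sqsubset>\<^bsub>T\<^esub> v" if "u \<noteq> w" "w \<noteq> v"
    using w that unfolding lless_tchebyshev by (auto simp: tchebyshev_def)
  ultimately have "w = v" using uv unfolding covers_def by blast
  with w(1) show ?thesis by simp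
qed

lemma interval_fibration_tchebyshev:
  "interval_fibration T P (\<lambda>u. the (snd (the u)))"
proof -
  let ?\<pi> = "\<lambda>u::('a option \<times> 'a option) option. the (snd (the u))"
  interpret T: finite_bounded_poset T by (rule finite_bounded_poset_tchebyshev)
  note bounds = finite_bounded_poset_tchebyshev(2,3)
  show ?thesis
  proof
    show "\<bottom>\<^bsub>T\<^esub> \<noteq> \<top>\<^bsub>T\<^esub>" "?\<pi> \<bottom>\<^bsub>T\<^esub> = \<bottom>" by (simp_all add: bounds)
    show "?\<pi> u \<in> carrier P" if "u \<in> carrier T - {\<top>\<^bsub>T\<^esub>}" for u
      using that by (auto simp: bounds intervals_iff)
    have covers_Some: "covers P (the y) (the w)"
      if "(x, y) \<in> intervals P" "covers P0 y w" for x y w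
    proof -
      obtain y' where "y = Some y'" using \<open>(x, y) \<in> intervals P\<close> by (auto simp: intervals_iff)
      then show ?thesis
        using that(2) covers_adjoin_bottom_Some[OF partial_order_axioms, of y' w] by auto
    qed
    show "covers P (?\<pi> u) (?\<pi> v)" if "covers T u v" "v \<noteq> \<top>\<^bsub>T\<^esub>" for u v
      using covers_tchebyshev[OF that(1)]
    proof cases
      case (shift x y w)
      then show ?thesis using covers_Some[OF shift(3,4)] by simp
    next
      case (extend x y w)
      then show ?thesis using covers_Some[OF extend(3,4)] by simp
    qed (use that(2) bounds in simp)
  next
    fix u y' assume u: "u \<in> carrier T - {\<top>\<^bsub>T\<^esub>}" and y': "y' \<in> carrier P"
    then obtain x v where uv: "u = Some (x, v)" "(x, v) \<in> intervals P"
      by (auto simp: bounds)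
    then obtain y where "v = Some y" by (auto simp: intervals_iff)
    with uv have u': "u = Some (x, Some y)" and xy: "(x, Some y) \<in> intervals P" by simp_all
    have y: "y \<in> carrier P" using xy by (auto simp: intervals_iff)
    (* The value z = y' cannot name an interval that ends at y', so it is free to stand for [x, y']. *)
    let ?g = "\<lambda>z. Some (if z = y' then x else Some z, Some y')"
    let ?F = "{v \<in> carrier T - {\<top>\<^bsub>T\<^esub>}. u \<sqsubseteq>\<^bsub>T\<^esub> v \<and> ?\<pi> v = y'}"
    (* x lies strictly below y, so [x, y'] differs from every [z, y'] with z above y. *)
    have xlt: "x \<noteq> Some z" if "z \<in> \<lbrace>y..y'\<rbrace>" for z
      using that xy y le_antisym[of z y] by (auto simp: at_least_at_most_def intervals_iff)
    have "bij_betw ?g \<lbrace>y..y'\<rbrace> ?F"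
      unfolding bij_betw_def
    proof (intro conjI equalityI subsetI)
      show "inj_on ?g \<lbrace>y..y'\<rbrace>"
      proof (rule inj_onI)
        fix z w assume zw: "z \<in> \<lbrace>y..y'\<rbrace>" "w \<in> \<lbrace>y..y'\<rbrace>" and "?g z = ?g w"
        then have "(if z = y' then x else Some z) = (if w = y' then x else Some w)" by simp
        then show "z = w" using xlt[OF zw(1)] xlt[OF zw(2)] by (simp split: if_splits)
      qed
    next
      fix v assume "v \<in> ?g ` \<lbrace>y..y'\<rbrace>"
      then obtain z where v: "v = ?g z" and z: "z \<in> carrier P" "y \<sqsubseteq> z" "z \<sqsubseteq> y'"
        by (auto simp: at_least_at_most_def)
      have yy': "y \<sqsubseteq> y'" using z y y' le_trans[of y z y'] by simp
      have "(x, Some y') \<in> intervals P"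
        using extend_le_tchebyshev[OF xy, of "Some y'"] y' yy' by simp
      moreover have "z \<noteq> y' \<Longrightarrow> (Some z, Some y') \<in> intervals P"
        using z y' by (simp add: intervals_iff)
      ultimately show "v \<in> ?F"
        using z yy' by (simp add: v u' bounds le_tchebyshev_Some[OF xy])
    next
      fix v assume "v \<in> ?F"
      then obtain x' where v: "v = Some (x', Some y')" and iv: "(x', Some y') \<in> intervals P"
        and le: "u \<sqsubseteq>\<^bsub>T\<^esub> v"
        by (auto simp: bounds intervals_iff)
      from le consider "x' = x" "y \<sqsubseteq> y'" | "Some y \<sqsubseteq>\<^bsub>P0\<^esub> x'"
        unfolding u' v le_tchebyshev_Some[OF xy] by auto
      then show "v \<in> ?g ` \<lbrace>y..y'\<rbrace>"
      proof cases
        case 1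
        then show ?thesis
          using y' by (intro image_eqI[of _ _ y']) (auto simp: v at_least_at_most_def)
      next
        case 2
        then obtain z where "x' = Some z" by (cases x') auto
        then show ?thesis
          using 2 iv by (intro image_eqI[of _ _ z]) (auto simp: v at_least_at_most_def intervals_iff)
      qed
    qed
    then show "card ?F = card \<lbrace>?\<pi> u..y'\<rbrace>"
      by (simp add: u' bij_betw_same_card)
  qed
qed

end

theorem theorem9p1:
  fixes P :: "'a gorder" and Q :: "'b gorder"
  assumes "graded_poset P" and "graded_poset Q"
    and "rk P \<top>\<^bsub>P\<^esub> \<ge> 1" and "rk Q \<top>\<^bsub>Q\<^esub> \<ge> 1"
  shows "\<Psi> (tchebyshev (P \<times>\<^sub>p Q)) = \<Psi> (tchebyshev P \<diamondop>\<^sup>* tchebyshev Q)"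
proof -
  have "\<Psi> (tchebyshev (P \<times>\<^sub>p Q)) = interval_chain_sum (P \<times>\<^sub>p Q)"
    by (rule interval_fibration.ab_index_eq_interval_chain_sum[OF
          graded_poset.interval_fibration_tchebyshev[OF graded_poset_prod(1)[OF assms(1,2)]]])
  moreover have "\<Psi> (tchebyshev P \<diamondop>\<^sup>* tchebyshev Q) = interval_chain_sum (P \<times>\<^sub>p Q)"
    by (rule interval_fibration.ab_index_eq_interval_chain_sum[OF interval_fibration_dual_diamond[OF
          graded_poset.interval_fibration_tchebyshev[OF assms(1)]
          graded_poset.interval_fibration_tchebyshev[OF assms(2)]]])
  ultimately show ?thesis by simp
qed

end
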